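(* Let $\mathcal{H}$ be a real Hilbert space with $\dim \mathcal{H}<\infty$, suppose that the sets $C_1,\dots,C_M\subset\mathcal{H}$ are nonempty, closed and convex with $C:=\bigcap_{i=1}^M C_i\neq\emptyset$, and let $x_0\in\mathcal{H}$. Let $\{x_k\}_{k\ge0}$, with intermediate points $x_{k,j}$, be generated from $x_0$ with stepsizes $\{\lambda_k\}_{k\ge0}$ by a chosen one of the cyclic, sequential or parallel projection algorithms described in the context. Assume that the real-valued convex functions $f_1,\dots,f_N$ are defined on some convex subsets $D_1,\dots,D_N$ of $\mathcal{H}$, respectively, such that $x_{k,j-1}\in D_j$ for all $j\in\{1,\dots,N\}$ and $k\ge0$ (for the chosen algorithm), and that there exist constants $L_1,\dots,L_N$ such that $$\max_{v\in\partial f_j(x_{k,j-1})}\|v\|\le L_j,\qquad j=1,2,\dots,N,\quad k\ge0.$$ Moreover, assume that the sequence $\{x_k\}$ (obtained via the chosen method) is bounded and that $$0<\lambda_k\to0\quad\text{and}\quad\sum_{k=0}^\infty\lambda_k=\infty.$$ Let $f(x):=\sum_{j=1}^N f_j(x)$. Then the sequence $\{f(x_k)\}$ converges to the optimal value $f^*:=\inf_{x\in C}f(x)$, and every cluster point of $\{x_k\}$ is an optimal solution of the problem $\min_{x\in C}f(x)$, given that the solution set $\{x^*\in C: f(x^* )=\inf_{x\in C}f(x)\}$ is nonempty.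
   Context: $M,N$ are positive integers. For a convex subset $D$ of $\mathcal{H}$, a convex function $g:D\to\mathbb{R}$ and $x\in D$, the subdifferential is $\partial g(x)=\{v\in\mathcal{H}: g(y)\ge g(x)+\langle y-x,v\rangle\ \text{for all } y\in D\}$. For a nonempty closed convex set $K\subset\mathcal{H}$, $P_K$ is the nearest point projection from $\mathcal{H}$ onto $K$. Projection algorithm: given $x_0\in\mathcal{H}$ and stepsizes $\lambda_k$, for each $k\ge0$ set $x_{k,0}=x_k$; $x_{k,j}=x_{k,j-1}-\lambda_k v_{k,j}$ with $v_{k,j}\in\partial f_j(x_{k,j-1})$, $j=1,2,\dots,N$; and $x_{k+1}=V_{k+1}(x_{k,N})$, where - sequential projections: $V_{k+1}=P_{C_M}\cdots P_{C_1}$; - cyclic projections: $V_{k+1}=P_{C_{[k+1]}}$ with $[k+1]=(k\bmod M)+1$; - parallel projections: $V_{k+1}=\sum_{i=1}^M\beta_iP_{C_i}$ with $\beta_i>0$ for all $i$ and $\sum_{i=1}^M\beta_i=1$.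
   Formalization: The formal theorem also assumes that each f_j is defined on C and at all x_k, and that f_j is continuous at every point of C relative to D_j; without this continuity the claim fails for convex f_j that jump at the boundary of D_j. *)

theory Defs
  imports "HOL-Analysis.Analysis"
begin

definition subdifferential ::
    "'a::real_inner set \<Rightarrow> ('a \<Rightarrow> real) \<Rightarrow> 'a \<Rightarrow> 'a set" where
  "subdifferential D g x = {v. \<forall>y\<in>D. g y \<ge> g x + (y - x) \<bullet> v}"

(* The library function closest_point is the nearest point projection; its sort is
   {real_inner, heine_borel}. A finite-dimensional real inner product space, the zero
   space included, always satisfies heine_borel, so this sort costs no generality. *)

primrec sequential_projection ::
    "(nat \<Rightarrow> 'a::{real_inner,heine_borel} set) \<Rightarrow> nat \<Rightarrow> 'a \<Rightarrow> 'a" where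
  "sequential_projection C 0 x = x"
| "sequential_projection C (Suc m) x = closest_point (C (Suc m)) (sequential_projection C m x)"

datatype projection_scheme =
    Sequential
  | Cyclic
  | Parallel "nat \<Rightarrow> real"

primrec valid_scheme :: "nat \<Rightarrow> projection_scheme \<Rightarrow> bool" where
  "valid_scheme M Sequential \<longleftrightarrow> True"
| "valid_scheme M Cyclic \<longleftrightarrow> True"
| "valid_scheme M (Parallel \<beta>) \<longleftrightarrow> (\<forall>i\<in>{1..M}. \<beta> i > 0) \<and> (\<Sum>i=1..M. \<beta> i) = 1"

(* The sets are C 1, ..., C M. The operator with argument k is the one written
   V_(k+1), i.e. the one that produces the iterate x (k + 1). *)
primrec scheme_operator ::
    "projection_scheme \<Rightarrow> (nat \<Rightarrow> 'a::{real_inner,heine_borel} set) \<Rightarrow> nat \<Rightarrow> nat \<Rightarrow> 'a \<Rightarrow> 'a"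
  where
  "scheme_operator Sequential C M k x = sequential_projection C M x"
| "scheme_operator Cyclic C M k x = closest_point (C (k mod M + 1)) x"
| "scheme_operator (Parallel \<beta>) C M k x = (\<Sum>i=1..M. \<beta> i *\<^sub>R closest_point (C i) x)"

(* y k j is the intermediate point x_(k,j). The subgradients are an arbitrary choice,
   so the algorithm is a relation between x0 and its possible runs (x, y). *)
definition generated_by_algorithm ::
    "projection_scheme \<Rightarrow> (nat \<Rightarrow> 'a::{real_inner,heine_borel} set) \<Rightarrow> nat \<Rightarrow>
     (nat \<Rightarrow> 'a set) \<Rightarrow> (nat \<Rightarrow> 'a \<Rightarrow> real) \<Rightarrow> nat \<Rightarrow> (nat \<Rightarrow> real) \<Rightarrow> 'a \<Rightarrow>
     (nat \<Rightarrow> 'a) \<Rightarrow> (nat \<Rightarrow> nat \<Rightarrow> 'a) \<Rightarrow> bool" where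
  "generated_by_algorithm s C M D f N lam x0 x y \<longleftrightarrow>
     x 0 = x0 \<and>
     (\<forall>k. y k 0 = x k \<and>
          (\<forall>j\<in>{1..N}. \<exists>v \<in> subdifferential (D j) (f j) (y k (j - 1)).
              y k j = y k (j - 1) - lam k *\<^sub>R v) \<and>
          x (Suc k) = scheme_operator s C M k (y k N))"

definition objective :: "(nat \<Rightarrow> 'a \<Rightarrow> real) \<Rightarrow> nat \<Rightarrow> 'a \<Rightarrow> real" where
  "objective f N x = (\<Sum>j=1..N. f j x)"

(* Taken in the extended reals, since the infimum of a function unbounded below
   has no meaningful value in type real. *)
definition optimal_value :: "'a set \<Rightarrow> ('a \<Rightarrow> real) \<Rightarrow> ereal" where
  "optimal_value S g = (INF x\<in>S. ereal (g x))"

definition solution_set :: "'a set \<Rightarrow> ('a \<Rightarrow> real) \<Rightarrow> 'a set" where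
  "solution_set S g = {x \<in> S. ereal (g x) = optimal_value S g}"

definition cluster_point :: "(nat \<Rightarrow> 'a::topological_space) \<Rightarrow> 'a \<Rightarrow> bool" where
  "cluster_point x z \<longleftrightarrow> (\<exists>r. strict_mono (r :: nat \<Rightarrow> nat) \<and> (x \<circ> r) \<longlonglongrightarrow> z)"

end

theory Submission
  imports Defs
begin

text \<open>
  The argument has two halves, feasibility and optimality, and both rest on the same elementary
  criterion (\<open>tendsto_0_if_decreasing_above_each_level\<close>): a nonnegative sequence tends
  to zero if its increases become small and if, whenever it exceeds a given level, it decreases at
  a rate whose sum diverges.

  Feasibility. A subgradient pass moves the iterate by \<open>O(lam k)\<close>, so the iteration is a
  vanishing perturbation of the projection scheme. The operators of all three schemes are
  strictly attracting: nonexpansive, and strictly decreasing the distance to each point of their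
  fixed point set from outside it. One period of any scheme is strictly attracting towards
  \<open>C\<close>; on a bounded set this decrease is uniform at each positive distance from
  \<open>C\<close>, and the criterion with constant weights gives
  \<open>dist (x k) C \<longlonglongrightarrow> 0\<close>.

  Optimality. For \<open>z\<close> in \<open>C\<close> the subgradient inequalities give
  \<open>|x (k + 1) - z|^2 \<le> |x k - z|^2 - 2 * lam k * (f (x k) - f z - E k)\<close>.
  They evaluate \<open>f j\<close> at the intermediate points, and \<open>E k\<close> contains the
  resulting change \<open>f j (x k) - f j (y k (j - 1))\<close>. The bounded subgradients at the
  intermediate point bound this change from below only; an upper bound would need subgradients of
  \<open>f j\<close> at \<open>x k\<close>, of which nothing is known for \<open>j > 1\<close>. But the
  iterates approach \<open>C\<close>, where the functions are continuous, so by compactness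
  \<open>E k \<longlonglongrightarrow> 0\<close>. Outside each neighbourhood of the solution set, the late
  iterates have values above the optimal one by a fixed amount, again by compactness. So the
  criterion, with the stepsizes as weights, applies to the squared distance to the solution set.
  This distance tends to zero, and both conclusions follow by continuity.
\<close>

section \<open>A convergence criterion and a compactness principle\<close>

text \<open>
  Above the level \<open>e\<close> the sequence decreases at a rate whose sum diverges, so it has to drop
  below \<open>e\<close> infinitely often; once below, the small increments keep it near \<open>e\<close>,
  because any excess is immediately followed by a decrease.
\<close>

lemma tendsto_0_if_decreasing_above_each_level:
  fixes d a :: "nat \<Rightarrow> real"
  assumes d_nonneg: "\<And>k. 0 \<le> d k"
    and a_nonneg: "\<And>k. 0 \<le> a k"
    and diverges: "filterlim (\<lambda>n. \<Sum>k<n. a k) at_top sequentially"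
    and small_increments: "\<And>e. e > 0 \<Longrightarrow> eventually (\<lambda>k. d (Suc k) \<le> d k + e) sequentially"
    and decrease: "\<And>e. e > 0 \<Longrightarrow>
      \<exists>\<delta>>0. eventually (\<lambda>k. e \<le> d k \<longrightarrow> d (Suc k) \<le> d k - \<delta> * a k) sequentially"
  shows "d \<longlonglongrightarrow> 0"
proof (rule LIMSEQ_I)
  fix e :: real
  assume "e > 0"
  then have "e / 2 > 0" by simp
  from decrease[OF this] obtain \<delta> where "\<delta> > 0"
    and decreasing:
      "eventually (\<lambda>k. e / 2 \<le> d k \<longrightarrow> d (Suc k) \<le> d k - \<delta> * a k) sequentially"
    by blast
  from decreasing small_increments[OF \<open>e / 2 > 0\<close>]
  have "eventually (\<lambda>k. d (Suc k) \<le> d k + e / 2 \<and>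
      (e / 2 \<le> d k \<longrightarrow> d (Suc k) \<le> d k - \<delta> * a k)) sequentially"
    by eventually_elim blast
  then obtain n0 where up: "\<And>k. k \<ge> n0 \<Longrightarrow> d (Suc k) \<le> d k + e / 2"
    and down: "\<And>k. k \<ge> n0 \<Longrightarrow> e / 2 \<le> d k \<Longrightarrow> d (Suc k) \<le> d k - \<delta> * a k"
    by (auto simp: eventually_sequentially)
  have "\<exists>k\<ge>n0. d k < e / 2"
  proof (rule ccontr)
    assume "\<not> (\<exists>k\<ge>n0. d k < e / 2)"
    then have above: "e / 2 \<le> d k" if "k \<ge> n0" for k
      using that by force
    have sum_bound: "\<delta> * (\<Sum>k<n. a k) \<le> \<delta> * (\<Sum>k<n0. a k) + d n0 - d n" if "n \<ge> n0" for n
      using that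
    proof (induction n rule: dec_induct)
      case base
      then show ?case by simp
    next
      case (step n)
      then show ?case
        using down[of n] above[of n] by (simp add: algebra_simps)
    qed
    have "eventually (\<lambda>n. (\<Sum>k<n. a k) \<ge> (\<Sum>k<n0. a k) + (d n0 + 1) / \<delta>) sequentially"
      using diverges by (simp add: filterlim_at_top)
    then obtain n where "n \<ge> n0" and large: "(\<Sum>k<n. a k) \<ge> (\<Sum>k<n0. a k) + (d n0 + 1) / \<delta>"
      by (metis eventually_sequentially le_cases order_refl)
    have "\<delta> * ((\<Sum>k<n0. a k) + (d n0 + 1) / \<delta>) \<le> \<delta> * (\<Sum>k<n. a k)"
      using large \<open>\<delta> > 0\<close> by simp
    moreover have "\<delta> * ((\<Sum>k<n0. a k) + (d n0 + 1) / \<delta>) = \<delta> * (\<Sum>k<n0. a k) + (d n0 + 1)"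
      using \<open>\<delta> > 0\<close> by (simp only: distrib_left) simp
    ultimately have "\<delta> * (\<Sum>k<n0. a k) + d n0 + 1 \<le> \<delta> * (\<Sum>k<n. a k)"
      by linarith
    then show False
      using sum_bound[OF \<open>n \<ge> n0\<close>] d_nonneg[of n] by linarith
  qed
  then obtain k0 where "k0 \<ge> n0" and "d k0 < e / 2" by blast
  have "d n < e" if "n \<ge> k0" for n
    using that
  proof (induction n rule: dec_induct)
    case base
    then show ?case using \<open>d k0 < e / 2\<close> \<open>e > 0\<close> by linarith
  next
    case (step n)
    show ?case
    proof (cases "d n < e / 2")
      case True
      then show ?thesis using up[of n] step \<open>k0 \<ge> n0\<close> by linarith
    next
      case False
      have "0 \<le> \<delta> * a n" using \<open>\<delta> > 0\<close> a_nonneg[of n] by simp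
      then show ?thesis using False down[of n] step \<open>k0 \<ge> n0\<close> by linarith
    qed
  qed
  then show "\<exists>n0. \<forall>n\<ge>n0. norm (d n - 0) < e"
    using d_nonneg by (metis abs_of_nonneg diff_zero real_norm_def)
qed

text \<open>
  Every claim below about all late iterates is reduced by this lemma to one about subsequences
  that converge. It says that a bounded sequence has no other way of violating \<open>P\<close>
  infinitely often.
\<close>

lemma eventually_if_along_convergent_subsequences:
  fixes x :: "nat \<Rightarrow> 'a::heine_borel"
  assumes "bounded (range x)"
    and along: "\<And>r z. strict_mono r \<Longrightarrow> (\<lambda>n. x (r n)) \<longlonglongrightarrow> z \<Longrightarrow>
      eventually (\<lambda>n. P (r n)) sequentially"
  shows "eventually P sequentially"
proof (rule ccontr)
  assume "\<not> eventually P sequentially"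
  then have "infinite {n. \<not> P n}"
    by (simp add: cofinite_eq_sequentially[symmetric] eventually_cofinite)
  then obtain r :: "nat \<Rightarrow> nat" where "strict_mono r" and fails: "\<And>n. \<not> P (r n)"
    using infinite_enumerate by blast
  have "bounded (range (x \<circ> r))"
    using \<open>bounded (range x)\<close> by (rule bounded_subset) auto
  then obtain z q where "strict_mono q" and "((x \<circ> r) \<circ> q) \<longlonglongrightarrow> z"
    using bounded_imp_convergent_subsequence by blast
  then have "strict_mono (\<lambda>n. r (q n))" and "(\<lambda>n. x (r (q n))) \<longlonglongrightarrow> z"
    using \<open>strict_mono r\<close> by (auto simp: strict_mono_def comp_def)
  from along[OF this] fails show False
    by (simp add: eventually_False)
qed

lemma subsequence_limit_in_closed:
  fixes x :: "nat \<Rightarrow> 'a::metric_space"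
  assumes "closed K" "K \<noteq> {}" and to_K: "(\<lambda>k. infdist (x k) K) \<longlonglongrightarrow> 0"
    and "strict_mono r" and lim: "(\<lambda>n. x (r n)) \<longlonglongrightarrow> z"
  shows "z \<in> K"
proof -
  have "(\<lambda>n. infdist (x (r n)) K) \<longlonglongrightarrow> 0"
    using LIMSEQ_subseq_LIMSEQ[OF to_K \<open>strict_mono r\<close>] by (simp add: comp_def)
  moreover have "(\<lambda>n. infdist (x (r n)) K) \<longlonglongrightarrow> infdist z K"
    using lim by (rule tendsto_infdist)
  ultimately have "infdist z K = 0"
    by (rule LIMSEQ_unique[symmetric])
  then show ?thesis
    using assms by (simp add: in_closed_iff_infdist_zero)
qed

lemma continuous_within_along_sequence:
  fixes g :: "'a::metric_space \<Rightarrow> 'b::metric_space"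
  assumes "continuous (at z within X) g" "\<And>n. w n \<in> X" "w \<longlonglongrightarrow> z"
  shows "(\<lambda>n. g (w n)) \<longlonglongrightarrow> g z"
  using assms by (auto simp: continuous_within_sequentially comp_def)

text \<open>
  The function is continuous only at the points of \<open>K\<close>, but along convergent
  subsequences both arguments approach the same point of \<open>K\<close>.
\<close>

lemma nearby_values_near_set_of_continuity:
  fixes a b :: "nat \<Rightarrow> 'a::heine_borel" and g :: "'a \<Rightarrow> real"
  assumes K: "closed K" "K \<noteq> {}"
    and cont: "\<And>z. z \<in> K \<Longrightarrow> continuous (at z within X) g"
    and in_X: "\<And>k. a k \<in> X" "\<And>k. b k \<in> X"
    and "bounded (range a)"
    and to_K: "(\<lambda>k. infdist (a k) K) \<longlonglongrightarrow> 0"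
    and near: "(\<lambda>k. dist (b k) (a k)) \<longlonglongrightarrow> 0"
  shows "(\<lambda>k. g (b k) - g (a k)) \<longlonglongrightarrow> 0"
proof (rule tendstoI)
  fix e :: real
  assume "e > 0"
  show "eventually (\<lambda>k. dist (g (b k) - g (a k)) 0 < e) sequentially"
  proof (rule eventually_if_along_convergent_subsequences[OF \<open>bounded (range a)\<close>])
    fix r z
    assume r: "strict_mono r" and lim_a: "(\<lambda>n. a (r n)) \<longlonglongrightarrow> z"
    then have "z \<in> K"
      using subsequence_limit_in_closed[OF K to_K] by blast
    have "(\<lambda>n. dist (b (r n)) (a (r n))) \<longlonglongrightarrow> 0"
      using LIMSEQ_subseq_LIMSEQ[OF near r] by (simp add: comp_def)
    then have "(\<lambda>n. dist (b (r n)) (a (r n)) + dist (a (r n)) z) \<longlonglongrightarrow> 0 + 0"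
      using lim_a[THEN tendsto_dist_iff[THEN iffD1]] by (rule tendsto_add)
    then have "(\<lambda>n. dist (b (r n)) z) \<longlonglongrightarrow> 0"
      by (intro tendsto_sandwich[of "\<lambda>_. 0" "\<lambda>n. dist (b (r n)) z"])
        (auto intro: always_eventually dist_triangle)
    then have lim_b: "(\<lambda>n. b (r n)) \<longlonglongrightarrow> z"
      by (rule tendsto_dist_iff[THEN iffD2])
    have "(\<lambda>n. g (b (r n)) - g (a (r n))) \<longlonglongrightarrow> g z - g z"
      by (intro tendsto_diff continuous_within_along_sequence[OF cont[OF \<open>z \<in> K\<close>]]
          in_X lim_a lim_b)
    then show "eventually (\<lambda>n. dist (g (b (r n)) - g (a (r n))) 0 < e) sequentially"
      using \<open>e > 0\<close> by (simp add: tendsto_iff)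
  qed
qed

section \<open>Strictly attracting operators\<close>

text \<open>
  The common core of the three projection schemes. Unlike nonexpansiveness alone, the strict
  inequality off \<open>F\<close> passes to compositions and convex combinations, and then with
  the intersection of the individual fixed point sets in place of \<open>F\<close>.
\<close>

definition strictly_attracting :: "('a::metric_space \<Rightarrow> 'a) \<Rightarrow> 'a set \<Rightarrow> bool" where
  "strictly_attracting V F \<longleftrightarrow>
     (\<forall>u w. dist (V u) (V w) \<le> dist u w) \<and>
     (\<forall>z\<in>F. V z = z) \<and>
     (\<forall>z\<in>F. \<forall>u. u \<notin> F \<longrightarrow> dist (V u) z < dist u z)"

lemma strictly_attracting_closest_point:
  fixes S :: "'a::{real_inner,heine_borel} set"
  assumes S: "S \<noteq> {}" "closed S" "convex S"
  shows "strictly_attracting (closest_point S) S"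
proof -
  have "dist (closest_point S u) z < dist u z" if "z \<in> S" "u \<notin> S" for z u
  proof -
    let ?p = "closest_point S u"
    have "u \<noteq> ?p"
      using closest_point_in_set[OF \<open>closed S\<close> \<open>S \<noteq> {}\<close>, of u] that by metis
    have "(u - ?p) \<bullet> (z - ?p) \<le> 0"
      using S that by (simp add: closest_point_dot)
    moreover have "(norm (u - z))\<^sup>2 =
        (norm (u - ?p))\<^sup>2 + (norm (?p - z))\<^sup>2 - 2 * ((u - ?p) \<bullet> (z - ?p))"
      by (simp add: power2_norm_eq_inner algebra_simps inner_commute)
    moreover have "0 < (norm (u - ?p))\<^sup>2"
      using \<open>u \<noteq> ?p\<close> by simp
    ultimately have "(norm (?p - z))\<^sup>2 < (norm (u - z))\<^sup>2"
      by linarith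
    then show ?thesis
      by (simp add: dist_norm power2_less_imp_less)
  qed
  then show ?thesis
    using S closest_point_lipschitz[of S]
    by (auto simp: strictly_attracting_def closest_point_self)
qed

lemma strictly_attracting_compose:
  assumes V: "strictly_attracting V F" and W: "strictly_attracting W G"
  shows "strictly_attracting (\<lambda>u. W (V u)) (F \<inter> G)"
proof -
  have "dist (W (V u)) z < dist u z" if "z \<in> F \<inter> G" "u \<notin> F \<inter> G" for z u
  proof (cases "u \<in> F")
    case True
    then show ?thesis using V W that by (auto simp: strictly_attracting_def)
  next
    case False
    have "dist (W (V u)) z \<le> dist (V u) z"
      using W that unfolding strictly_attracting_def by (metis IntD2)
    also have "\<dots> < dist u z"
      using V that False unfolding strictly_attracting_def by blast
    finally show ?thesis .
  qed
  moreover have "dist (W (V u)) (W (V w)) \<le> dist u w" for u w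
    using V W unfolding strictly_attracting_def by (meson order_trans)
  ultimately show ?thesis
    using V W by (auto simp: strictly_attracting_def)
qed

lemma strictly_attracting_convex_combination:
  fixes P :: "nat \<Rightarrow> 'a::real_normed_vector \<Rightarrow> 'a"
  assumes "finite I"
    and attr: "\<And>i. i \<in> I \<Longrightarrow> strictly_attracting (P i) (F i)"
    and \<beta>_pos: "\<And>i. i \<in> I \<Longrightarrow> \<beta> i > 0" and \<beta>_sum: "(\<Sum>i\<in>I. \<beta> i) = 1"
  shows "strictly_attracting (\<lambda>u. \<Sum>i\<in>I. \<beta> i *\<^sub>R P i u) (\<Inter>i\<in>I. F i)"
proof -
  have dist_le: "dist (\<Sum>i\<in>I. \<beta> i *\<^sub>R p i) (\<Sum>i\<in>I. \<beta> i *\<^sub>R q i) \<le> (\<Sum>i\<in>I. \<beta> i * dist (p i) (q i))"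
    for p q :: "nat \<Rightarrow> 'a"
  proof -
    have "norm (\<Sum>i\<in>I. \<beta> i *\<^sub>R (p i - q i)) \<le> (\<Sum>i\<in>I. norm (\<beta> i *\<^sub>R (p i - q i)))"
      by (rule norm_sum)
    also have "\<dots> = (\<Sum>i\<in>I. \<beta> i * dist (p i) (q i))"
      using \<beta>_pos by (intro sum.cong) (auto simp: dist_norm less_imp_le)
    finally show ?thesis
      by (simp add: dist_norm scaleR_diff_right sum_subtractf)
  qed
  have weighted: "(\<Sum>i\<in>I. \<beta> i * c) = c" for c :: real
    using \<beta>_sum by (simp add: sum_distrib_right[symmetric])
  have fixed: "(\<Sum>i\<in>I. \<beta> i *\<^sub>R z) = z" for z :: 'a
    using \<beta>_sum by (simp add: scaleR_left.sum[symmetric])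
  have nonexp: "\<beta> i * dist (P i u) (P i w) \<le> \<beta> i * dist u w" if "i \<in> I" for i u w
    using attr[OF that] \<beta>_pos[OF that] by (simp add: strictly_attracting_def)
  have "dist (\<Sum>i\<in>I. \<beta> i *\<^sub>R P i u) (\<Sum>i\<in>I. \<beta> i *\<^sub>R P i w) \<le> dist u w" for u w
  proof -
    have "(\<Sum>i\<in>I. \<beta> i * dist (P i u) (P i w)) \<le> (\<Sum>i\<in>I. \<beta> i * dist u w)"
      using nonexp by (rule sum_mono)
    then show ?thesis using dist_le[of "\<lambda>i. P i u" "\<lambda>i. P i w"] weighted by simp
  qed
  moreover have "(\<Sum>i\<in>I. \<beta> i *\<^sub>R P i z) = z" if "z \<in> (\<Inter>i\<in>I. F i)" for z
  proof -
    have "(\<Sum>i\<in>I. \<beta> i *\<^sub>R P i z) = (\<Sum>i\<in>I. \<beta> i *\<^sub>R z)"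
      using attr that by (intro sum.cong) (auto simp: strictly_attracting_def)
    then show ?thesis by (simp add: fixed)
  qed
  moreover have "dist (\<Sum>i\<in>I. \<beta> i *\<^sub>R P i u) z < dist u z"
    if z: "z \<in> (\<Inter>i\<in>I. F i)" and u: "u \<notin> (\<Inter>i\<in>I. F i)" for z u
  proof -
    have P_z: "P i z = z" if "i \<in> I" for i
      using attr[OF that] z that by (auto simp: strictly_attracting_def)
    obtain i where i: "i \<in> I" "u \<notin> F i" using u by blast
    have "(\<Sum>i\<in>I. \<beta> i * dist (P i u) z) < (\<Sum>i\<in>I. \<beta> i * dist u z)"
    proof (rule sum_strict_mono_ex1[OF \<open>finite I\<close>])
      show "\<forall>i\<in>I. \<beta> i * dist (P i u) z \<le> \<beta> i * dist u z"
        using nonexp[of _ u z] by (auto simp: P_z)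
      have "dist (P i u) z < dist u z"
        using attr[OF i(1)] i z by (auto simp: strictly_attracting_def)
      then show "\<exists>i\<in>I. \<beta> i * dist (P i u) z < \<beta> i * dist u z"
        using \<beta>_pos i(1) by auto
    qed
    then show ?thesis
      using dist_le[of "\<lambda>i. P i u" "\<lambda>_. z"] by (simp add: weighted fixed)
  qed
  ultimately show ?thesis
    by (auto simp: strictly_attracting_def)
qed

primrec compose_first :: "(nat \<Rightarrow> 'a \<Rightarrow> 'a) \<Rightarrow> nat \<Rightarrow> 'a \<Rightarrow> 'a" where
  "compose_first V 0 u = u"
| "compose_first V (Suc n) u = V n (compose_first V n u)"

lemma strictly_attracting_compose_first:
  assumes "\<And>i. i < n \<Longrightarrow> strictly_attracting (V i) (F i)"
  shows "strictly_attracting (compose_first V n) (\<Inter>i<n. F i)"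
  using assms
proof (induction n)
  case 0
  then show ?case by (simp add: strictly_attracting_def)
next
  case (Suc n)
  then have "strictly_attracting (\<lambda>u. V n (compose_first V n u)) ((\<Inter>i<n. F i) \<inter> F n)"
    by (intro strictly_attracting_compose) auto
  then show ?case
    by (simp add: lessThan_Suc Int_commute)
qed

lemma infdist_attained:
  fixes K :: "'a::heine_borel set"
  assumes "closed K" "K \<noteq> {}"
  obtains p where "p \<in> K" "infdist u K = dist u p"
proof -
  obtain p where p: "p \<in> K" "\<And>q. q \<in> K \<Longrightarrow> dist u p \<le> dist u q"
    using distance_attains_inf[OF assms, of u] by blast
  then have "infdist u K = dist u p"
    using assms by (intro antisym infdist_le) (auto simp: infdist_def intro: cINF_greatest)
  with p that show thesis by blast
qed

text \<open>
  Compactness makes the strict decrease uniform at every positive distance from \<open>K\<close>.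
\<close>

lemma strictly_attracting_uniform_decrease:
  fixes T :: "'a::heine_borel \<Rightarrow> 'a"
  assumes T: "strictly_attracting T K" and K: "closed K" "K \<noteq> {}" and "bounded B" and "e > 0"
  obtains \<delta> where "\<delta> > 0"
    and "\<And>u. u \<in> B \<Longrightarrow> e \<le> infdist u K \<Longrightarrow> infdist (T u) K \<le> infdist u K - \<delta>"
proof -
  let ?A = "closure B \<inter> {u. e \<le> infdist u K}"
  let ?h = "\<lambda>u. infdist u K - infdist (T u) K"
  show thesis
  proof (cases "?A = {}")
    case True
    then show ?thesis
      using that[of 1] closure_subset[of B] by fastforce
  next
    case False
    have "closed {u. e \<le> infdist u K}"
      by (intro closed_Collect_le continuous_intros)
    then have "compact ?A"
      using \<open>bounded B\<close> by (intro compact_Int_closed) (simp_all add: compact_closure)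
    moreover have "continuous_on ?A T"
      using T by (intro continuous_on_iff[THEN iffD2])
        (auto simp: strictly_attracting_def intro: le_less_trans)
    then have "continuous_on ?A ?h"
      by (intro continuous_intros)
    ultimately obtain u0 where u0: "u0 \<in> ?A" and min: "\<And>u. u \<in> ?A \<Longrightarrow> ?h u0 \<le> ?h u"
      using continuous_attains_inf[of ?A ?h] False by blast
    obtain p where p: "p \<in> K" "infdist u0 K = dist u0 p"
      using infdist_attained[OF K] by blast
    have "u0 \<notin> K"
      using u0 \<open>e > 0\<close> by auto
    have "infdist (T u0) K \<le> dist (T u0) p"
      using p by (intro infdist_le)
    also have "\<dots> < dist u0 p"
      using T p \<open>u0 \<notin> K\<close> by (simp add: strictly_attracting_def)
    finally have "?h u0 > 0"
      using p by simp
    moreover have "infdist (T u) K \<le> infdist u K - ?h u0" if "u \<in> B" "e \<le> infdist u K" for u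
      using min[of u] that closure_subset[of B] by force
    ultimately show ?thesis by (rule that)
  qed
qed

section \<open>Asymptotic feasibility\<close>

lemma infdist_strictly_attracting_le:
  fixes V :: "'a::heine_borel \<Rightarrow> 'a"
  assumes V: "strictly_attracting V F" and "K \<subseteq> F" and K: "closed K" "K \<noteq> {}"
  shows "infdist (V u) K \<le> infdist w K + dist u w"
proof -
  obtain p where p: "p \<in> K" "infdist w K = dist w p"
    using infdist_attained[OF K] by blast
  have "infdist (V u) K \<le> dist (V u) p"
    using p by (intro infdist_le)
  also have "\<dots> \<le> dist u p"
    using V p \<open>K \<subseteq> F\<close> unfolding strictly_attracting_def by (metis subsetD)
  also have "\<dots> \<le> dist u w + dist w p"
    by (rule dist_triangle)
  finally show ?thesis using p by simp
qed

text \<open>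
  A single operator need not bring the iterate closer to \<open>K\<close>, but a whole period does:
  its composition is strictly attracting towards \<open>K\<close>, and the perturbations within one
  period add up to something that vanishes in the limit. The distances at multiples of the
  period therefore tend to zero, and the other distances follow because each step increases the
  distance by at most the perturbation.
\<close>

lemma periodic_attracting_asymptotically_feasible:
  fixes V :: "nat \<Rightarrow> 'a::heine_borel \<Rightarrow> 'a"
  assumes "M > 0"
    and attr: "\<And>k. strictly_attracting (V k) (F k)"
    and periodic: "\<And>k. V (k + M) = V k"
    and K_eq: "K = (\<Inter>i<M. F i)" and K_sub: "\<And>k. K \<subseteq> F k"
    and K: "closed K" "K \<noteq> {}"
    and "bounded (range x)"
    and step: "\<And>k. x (Suc k) = V k (u k)"
    and perturb: "(\<lambda>k. dist (u k) (x k)) \<longlonglongrightarrow> 0"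
  shows "(\<lambda>k. infdist (x k) K) \<longlonglongrightarrow> 0"
proof -
  define e where "e k = dist (u k) (x k)" for k
  \<comment> \<open>\<open>\<eta> m j\<close> bounds how far the first \<open>j\<close> steps of the block of steps starting at
    \<open>m * M\<close> stray from the unperturbed composition.\<close>
  define \<eta> where "\<eta> m j = (\<Sum>i<j. e (m * M + i))" for m j
  let ?T = "compose_first V M"
  have T: "strictly_attracting ?T K"
    unfolding K_eq by (rule strictly_attracting_compose_first) (rule attr)
  have V_block: "V (m * M + j) = V j" for m j
  proof (induction m)
    case (Suc m)
    have "V (Suc m * M + j) = V ((m * M + j) + M)"
      by (simp add: algebra_simps)
    also have "\<dots> = V j" using Suc by (simp only: periodic)
    finally show ?case .
  qed simp
  have nonexp: "dist (V k p) (V k q) \<le> dist p q" for k p q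
    using attr[of k] by (simp add: strictly_attracting_def)
  have shadow: "dist (x (m * M + j)) (compose_first V j (x (m * M))) \<le> \<eta> m j" for m j
  proof (induction j)
    case 0
    then show ?case by (simp add: \<eta>_def)
  next
    case (Suc j)
    let ?k = "m * M + j" and ?c = "compose_first V j (x (m * M))"
    have "dist (x (Suc ?k)) (V j ?c) \<le> dist (u ?k) ?c"
      using step[of ?k] V_block[of m j] nonexp[of j] by metis
    also have "\<dots> \<le> e ?k + dist (x ?k) ?c"
      by (simp add: e_def dist_triangle)
    finally show ?case using Suc by (simp add: \<eta>_def)
  qed
  have block_inj: "strict_mono (\<lambda>m. m * M + i)" for i
    using \<open>M > 0\<close> by (simp add: strict_mono_def)
  have e_block: "(\<lambda>m. e (m * M + i)) \<longlonglongrightarrow> 0" for i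
    using LIMSEQ_subseq_LIMSEQ[OF perturb block_inj[of i]] by (simp add: comp_def e_def)
  then have \<eta>_null: "(\<lambda>m. \<eta> m j) \<longlonglongrightarrow> 0" for j
    unfolding \<eta>_def by (intro tendsto_null_sum)

  have block_start: "(\<lambda>m. infdist (x (m * M)) K) \<longlonglongrightarrow> 0"
  proof (rule tendsto_0_if_decreasing_above_each_level[where a = "\<lambda>_. 1"])
    show "filterlim (\<lambda>n. \<Sum>k<n. 1::real) at_top sequentially"
      by (simp add: filterlim_real_sequentially)
    have next_block: "infdist (x (Suc m * M)) K \<le> infdist (?T (x (m * M))) K + \<eta> m M" for m
      using infdist_triangle[of "x (Suc m * M)" K "?T (x (m * M))"] shadow[of m M]
      by (simp add: add.commute)
    show "eventually (\<lambda>m. infdist (x (Suc m * M)) K \<le> infdist (x (m * M)) K + e) sequentially"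
      if "e > 0" for e
    proof -
      have "eventually (\<lambda>m. \<eta> m M < e) sequentially"
        using \<eta>_null \<open>e > 0\<close> by (rule order_tendstoD)
      then show ?thesis
      proof eventually_elim
        case (elim m)
        show ?case
          using infdist_strictly_attracting_le[OF T order_refl K, of "x (m * M)" "x (m * M)"]
            next_block[of m] elim by simp
      qed
    qed
    show "\<exists>\<delta>>0. eventually (\<lambda>m. e \<le> infdist (x (m * M)) K \<longrightarrow>
        infdist (x (Suc m * M)) K \<le> infdist (x (m * M)) K - \<delta> * 1) sequentially"
      if "e > 0" for e
    proof -
      obtain \<delta> where "\<delta> > 0" and decrease: "\<And>w. w \<in> range x \<Longrightarrow> e \<le> infdist w K \<Longrightarrow>
          infdist (?T w) K \<le> infdist w K - \<delta>"
        using strictly_attracting_uniform_decrease[OF T K \<open>bounded (range x)\<close> \<open>e > 0\<close>] by blast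
      have "eventually (\<lambda>m. \<eta> m M < \<delta> / 2) sequentially"
        using \<eta>_null[of M] \<open>\<delta> > 0\<close> by (intro order_tendstoD) auto
      then have "eventually (\<lambda>m. e \<le> infdist (x (m * M)) K \<longrightarrow>
        infdist (x (Suc m * M)) K \<le> infdist (x (m * M)) K - \<delta> / 2 * 1) sequentially"
      proof eventually_elim
        case (elim m)
        show ?case
          using next_block[of m] decrease[of "x (m * M)"] elim by auto
      qed
      with \<open>\<delta> > 0\<close> show ?thesis by (intro exI[of _ "\<delta> / 2"]) simp
    qed
  qed (auto simp: infdist_nonneg)
  have block: "(\<lambda>m. infdist (x (m * M + j)) K) \<longlonglongrightarrow> 0" for j
  proof (induction j)
    case 0
    then show ?case using block_start by simp
  next
    case (Suc j)
    have "(\<lambda>m. infdist (x (m * M + j)) K + e (m * M + j)) \<longlonglongrightarrow> 0 + 0"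
      using Suc e_block by (rule tendsto_add)
    then have null: "(\<lambda>m. infdist (x (m * M + j)) K + e (m * M + j)) \<longlonglongrightarrow> 0"
      by simp
    have le: "infdist (x (m * M + Suc j)) K \<le> infdist (x (m * M + j)) K + e (m * M + j)" for m
      using infdist_strictly_attracting_le[OF attr K_sub K, of "m * M + j" "u (m * M + j)"]
      by (simp add: step e_def)
    show ?case
      by (rule tendsto_sandwich[OF always_eventually always_eventually tendsto_const null])
        (use le in \<open>auto simp: infdist_nonneg\<close>)
  qed
  show ?thesis
  proof (rule tendstoI)
    fix \<epsilon> :: real
    assume "\<epsilon> > 0"
    have "\<forall>j\<in>{..<M}. eventually (\<lambda>m. infdist (x (m * M + j)) K < \<epsilon>) sequentially"
      using order_tendstoD(2)[OF block \<open>\<epsilon> > 0\<close>] by blast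
    then have "eventually (\<lambda>m. \<forall>j\<in>{..<M}. infdist (x (m * M + j)) K < \<epsilon>) sequentially"
      by (intro eventually_ball_finite) auto
    then obtain m0 where m0: "\<And>m j. m \<ge> m0 \<Longrightarrow> j < M \<Longrightarrow> infdist (x (m * M + j)) K < \<epsilon>"
      by (auto simp: eventually_sequentially)
    have "infdist (x k) K < \<epsilon>" if "k \<ge> m0 * M" for k
    proof -
      have "m0 \<le> k div M"
        using that \<open>M > 0\<close> by (simp add: less_eq_div_iff_mult_less_eq)
      then show ?thesis
        using m0[of "k div M" "k mod M"] \<open>M > 0\<close> by simp
    qed
    then show "eventually (\<lambda>k. dist (infdist (x k) K) 0 < \<epsilon>) sequentially"
      by (auto simp: eventually_sequentially infdist_nonneg)
  qed
qed

lemma scheme_operator_periodic: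
  "scheme_operator s C M (k + M) = scheme_operator s C M k"
  by (cases s) (auto simp: fun_eq_iff)

lemma sequential_projection_eq_compose_first:
  "sequential_projection C m = compose_first (\<lambda>i. closest_point (C (Suc i))) m"
proof
  show "sequential_projection C m u = compose_first (\<lambda>i. closest_point (C (Suc i))) m u" for u
    by (induction m) simp_all
qed

lemma INT_Suc_lessThan: "(\<Inter>i<M. C (Suc i)) = (\<Inter>i\<in>{1..M}. C i)"
  by (simp only: image_Suc_lessThan[symmetric] INF_image comp_def)

text \<open>
  A cyclic projection is attracted to one of the sets only, the other two operators directly to
  the intersection; this is why the fixed point sets depend on the step.
\<close>

lemma scheme_operator_strictly_attracting:
  fixes C :: "nat \<Rightarrow> 'a::{real_inner,heine_borel} set"
  assumes "M > 0"
    and C: "\<And>i. i \<in> {1..M} \<Longrightarrow> C i \<noteq> {} \<and> closed (C i) \<and> convex (C i)"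
    and "valid_scheme M s"
  obtains F where "\<And>k. strictly_attracting (scheme_operator s C M k) (F k)"
    and "(\<Inter>i<M. F i) = (\<Inter>i\<in>{1..M}. C i)"
    and "\<And>k. (\<Inter>i\<in>{1..M}. C i) \<subseteq> F k"
proof -
  let ?K = "\<Inter>i\<in>{1..M}. C i"
  have proj: "strictly_attracting (closest_point (C i)) (C i)" if "i \<in> {1..M}" for i
    using C[OF that] by (intro strictly_attracting_closest_point) auto
  have all_equal: "(\<Inter>i<M. ?K) = ?K"
    using \<open>M > 0\<close> by auto
  show thesis
  proof (cases s)
    case Sequential
    have "strictly_attracting (sequential_projection C M) (\<Inter>i<M. C (Suc i))"
      unfolding sequential_projection_eq_compose_first
      by (rule strictly_attracting_compose_first) (simp add: proj)
    then have "strictly_attracting (sequential_projection C M) ?K"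
      by (simp only: INT_Suc_lessThan)
    moreover have "scheme_operator s C M k = sequential_projection C M" for k
      using Sequential by (simp add: fun_eq_iff)
    ultimately show thesis
      using all_equal by (intro that[of "\<lambda>_. ?K"]) simp_all
  next
    case Cyclic
    have in_range: "k mod M + 1 \<in> {1..M}" for k
      using \<open>M > 0\<close> by (simp add: Suc_leI)
    have "(\<Inter>i<M. C (i mod M + 1)) = (\<Inter>i<M. C (Suc i))"
      by simp
    then have "(\<Inter>i<M. C (i mod M + 1)) = ?K"
      by (simp only: INT_Suc_lessThan)
    moreover have "scheme_operator s C M k = closest_point (C (k mod M + 1))" for k
      using Cyclic by (simp add: fun_eq_iff)
    ultimately show thesis
      using proj[OF in_range] in_range by (intro that[of "\<lambda>k. C (k mod M + 1)"]) auto
  next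
    case (Parallel \<beta>)
    have "strictly_attracting (\<lambda>u. \<Sum>i\<in>{1..M}. \<beta> i *\<^sub>R closest_point (C i) u) ?K"
      using \<open>valid_scheme M s\<close> Parallel proj
      by (intro strictly_attracting_convex_combination) auto
    moreover have "scheme_operator s C M k = (\<lambda>u. \<Sum>i\<in>{1..M}. \<beta> i *\<^sub>R closest_point (C i) u)" for k
      using Parallel by (simp add: fun_eq_iff)
    ultimately show thesis
      using all_equal by (intro that[of "\<lambda>_. ?K"]) simp_all
  qed
qed

section \<open>One incremental subgradient pass\<close>

lemma incremental_subgradient_displacement:
  fixes p :: "nat \<Rightarrow> 'a::real_inner"
  assumes "t \<ge> 0" and step: "\<And>j. j \<in> {1..N} \<Longrightarrow> \<exists>v. norm v \<le> L j \<and> p j = p (j - 1) - t *\<^sub>R v"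
    and "n \<le> N"
  shows "dist (p n) (p 0) \<le> t * (\<Sum>j=1..n. L j)"
  using \<open>n \<le> N\<close>
proof (induction n)
  case 0
  then show ?case by simp
next
  case (Suc n)
  then obtain v where v: "norm v \<le> L (Suc n)" "p (Suc n) = p n - t *\<^sub>R v"
    using step[of "Suc n"] by auto
  have "dist (p (Suc n)) (p n) \<le> t * L (Suc n)"
    using v \<open>t \<ge> 0\<close> by (simp add: dist_norm mult_left_mono)
  then show ?case
    using Suc dist_triangle[of "p (Suc n)" "p 0" "p n"] by (simp add: algebra_simps)
qed

text \<open>
  The expansion of the square turns each subgradient inequality into a decrease of the squared
  distance to \<open>z\<close>; the values of the functions enter at the intermediate points.
\<close>

lemma incremental_subgradient_descent:
  fixes p :: "nat \<Rightarrow> 'a::real_inner"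
  assumes "t \<ge> 0"
    and step: "\<And>j. j \<in> {1..N} \<Longrightarrow> \<exists>v \<in> subdifferential (D j) (f j) (p (j - 1)).
      norm v \<le> L j \<and> p j = p (j - 1) - t *\<^sub>R v"
    and z: "\<And>j. j \<in> {1..N} \<Longrightarrow> z \<in> D j"
    and "n \<le> N"
  shows "(norm (p n - z))\<^sup>2 \<le> (norm (p 0 - z))\<^sup>2
    - 2 * t * (\<Sum>j=1..n. f j (p (j - 1)) - f j z) + t\<^sup>2 * (\<Sum>j=1..n. (L j)\<^sup>2)"
  using \<open>n \<le> N\<close>
proof (induction n)
  case 0
  then show ?case by simp
next
  case (Suc n)
  let ?j = "Suc n"
  from Suc.prems have j: "?j \<in> {1..N}" by simp
  from step[OF j] obtain v where v: "v \<in> subdifferential (D ?j) (f ?j) (p n)"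
    "norm v \<le> L ?j" "p ?j = p n - t *\<^sub>R v"
    by auto
  have "f ?j (p n) + (z - p n) \<bullet> v \<le> f ?j z"
    using v(1) z[OF j] by (auto simp: subdifferential_def)
  then have "f ?j (p n) - f ?j z \<le> (p n - z) \<bullet> v"
    by (simp add: inner_diff_left)
  then have "2 * t * (f ?j (p n) - f ?j z) \<le> 2 * t * ((p n - z) \<bullet> v)"
    using \<open>t \<ge> 0\<close> by (simp add: mult_left_mono)
  moreover have "t\<^sup>2 * (norm v)\<^sup>2 \<le> t\<^sup>2 * (L ?j)\<^sup>2"
    using v(2) by (intro mult_left_mono power_mono) auto
  moreover have "(norm (p ?j - z))\<^sup>2 =
      (norm (p n - z))\<^sup>2 - 2 * t * ((p n - z) \<bullet> v) + t\<^sup>2 * (norm v)\<^sup>2"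
    unfolding v(3) power2_norm_eq_inner
    by (simp add: algebra_simps inner_commute power2_eq_square)
  ultimately have "(norm (p ?j - z))\<^sup>2 \<le>
      (norm (p n - z))\<^sup>2 - 2 * t * (f ?j (p n) - f ?j z) + t\<^sup>2 * (L ?j)\<^sup>2"
    by linarith
  then show ?case
    using Suc by (simp add: algebra_simps)
qed

section \<open>Convergence to the solution set\<close>

text \<open>
  Away from the solution set \<open>S\<close> the objective exceeds its optimal value by a fixed
  amount at all late iterates, since these are nearly in \<open>K\<close> and compactness applies
  to the part of \<open>K\<close> away from \<open>S\<close>. The squared distance to \<open>S\<close>
  then satisfies the convergence criterion with the stepsizes as weights. The distance to a single
  solution would not do: at an iterate close to \<open>S\<close> but far from that solution there is
  no gap in the values to outweigh the error \<open>E k\<close>.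
\<close>

lemma descent_towards_minimizers:
  fixes x :: "nat \<Rightarrow> 'a::{real_normed_vector,heine_borel}" and g :: "'a \<Rightarrow> real"
  assumes K: "closed K" "K \<noteq> {}" "K \<subseteq> X"
    and cont: "\<And>z. z \<in> K \<Longrightarrow> continuous (at z within X) g"
    and in_X: "\<And>k. x k \<in> X"
    and S_eq: "S = {z \<in> K. g z = m}" and "S \<noteq> {}"
    and min: "\<And>z. z \<in> K \<Longrightarrow> m \<le> g z"
    and "bounded (range x)"
    and to_K: "(\<lambda>k. infdist (x k) K) \<longlonglongrightarrow> 0"
    and lam_pos: "\<And>k. lam k > 0"
    and lam_null: "lam \<longlonglongrightarrow> 0"
    and lam_diverges: "filterlim (\<lambda>n. \<Sum>k<n. lam k) at_top sequentially"
    and E_null: "E \<longlonglongrightarrow> 0"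
    and descent: "\<And>k z. z \<in> S \<Longrightarrow>
      (norm (x (Suc k) - z))\<^sup>2 \<le> (norm (x k - z))\<^sup>2 - 2 * lam k * (g (x k) - m - E k)"
  shows "closed S" and "(\<lambda>k. infdist (x k) S) \<longlonglongrightarrow> 0"
proof -
  have cont_K: "continuous_on K g"
    using cont \<open>K \<subseteq> X\<close> by (meson continuous_on_eq_continuous_within continuous_within_subset)
  show "closed S"
    unfolding S_eq using cont_K \<open>closed K\<close> by (rule continuous_closed_preimage_constant)
  have limit: "z \<in> K" "(\<lambda>n. g (x (r n))) \<longlonglongrightarrow> g z"
    if r: "strict_mono r" "(\<lambda>n. x (r n)) \<longlonglongrightarrow> z" for r z
  proof -
    show "z \<in> K"
      using subsequence_limit_in_closed[OF K(1,2) to_K] that by blast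
    then show "(\<lambda>n. g (x (r n))) \<longlonglongrightarrow> g z"
      using continuous_within_along_sequence[OF cont in_X] that by blast
  qed
  have almost_optimal: "eventually (\<lambda>k. m - 1 < g (x k)) sequentially"
  proof (rule eventually_if_along_convergent_subsequences[OF \<open>bounded (range x)\<close>])
    fix r z
    assume r: "strict_mono r" "(\<lambda>n. x (r n)) \<longlonglongrightarrow> z"
    have "m - 1 < g z" using min[OF limit(1)[OF r]] by simp
    with limit(2)[OF r] show "eventually (\<lambda>n. m - 1 < g (x (r n))) sequentially"
      by (rule order_tendstoD)
  qed
  have gap: "\<exists>\<delta>>0. eventually (\<lambda>k. e \<le> infdist (x k) S \<longrightarrow> m + \<delta> < g (x k)) sequentially"
    if "e > 0" for e
  proof -
    let ?A = "closure (range x) \<inter> K \<inter> {u. e \<le> infdist u S}"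
    obtain \<delta> where "\<delta> > 0" and \<delta>: "\<And>z. z \<in> ?A \<Longrightarrow> m + \<delta> < g z"
    proof (cases "?A = {}")
      case True
      then show ?thesis using that[of 1] by auto
    next
      case False
      have "closed {u. e \<le> infdist u S}"
        by (intro closed_Collect_le continuous_intros)
      then have "compact ?A"
        using \<open>bounded (range x)\<close> \<open>closed K\<close>
        by (intro compact_Int_closed) (simp_all add: compact_closure)
      moreover have "continuous_on ?A g"
        using cont_K by (rule continuous_on_subset) auto
      ultimately obtain z0 where z0: "z0 \<in> ?A" "\<And>z. z \<in> ?A \<Longrightarrow> g z0 \<le> g z"
        using continuous_attains_inf[of ?A g] False by blast
      have "z0 \<notin> S" using z0 \<open>e > 0\<close> by auto
      then have "m < g z0" using z0 min[of z0] by (force simp: S_eq)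
      then show ?thesis
        using that[of "(g z0 - m) / 2"] z0(2) by (fastforce simp: field_simps)
    qed
    have "eventually (\<lambda>k. e \<le> infdist (x k) S \<longrightarrow> m + \<delta> < g (x k)) sequentially"
    proof (rule eventually_if_along_convergent_subsequences[OF \<open>bounded (range x)\<close>])
      fix r z
      assume r: "strict_mono r" "(\<lambda>n. x (r n)) \<longlonglongrightarrow> z"
      show "eventually (\<lambda>n. e \<le> infdist (x (r n)) S \<longrightarrow> m + \<delta> < g (x (r n))) sequentially"
      proof (cases "e \<le> infdist z S")
        case True
        have "z \<in> closure (range x)"
          using r(2) by (auto simp: closure_sequential intro!: exI[of _ "\<lambda>n. x (r n)"])
        then have "m + \<delta> < g z" using True limit(1)[OF r] by (intro \<delta>) auto
        with limit(2)[OF r] have "eventually (\<lambda>n. m + \<delta> < g (x (r n))) sequentially"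
          by (rule order_tendstoD)
        then show ?thesis by eventually_elim blast
      next
        case False
        then have "eventually (\<lambda>n. infdist (x (r n)) S < e) sequentially"
          using tendsto_infdist[OF r(2)] by (intro order_tendstoD) auto
        then show ?thesis by eventually_elim simp
      qed
    qed
    with \<open>\<delta> > 0\<close> show ?thesis by blast
  qed
  have set_descent: "(infdist (x (Suc k)) S)\<^sup>2 \<le>
      (infdist (x k) S)\<^sup>2 - 2 * lam k * (g (x k) - m - E k)" for k
  proof -
    obtain p where p: "p \<in> S" "infdist (x k) S = dist (x k) p"
      using infdist_attained[OF \<open>closed S\<close> \<open>S \<noteq> {}\<close>] by blast
    have "(infdist (x (Suc k)) S)\<^sup>2 \<le> (norm (x (Suc k) - p))\<^sup>2"
      using infdist_le[OF p(1), of "x (Suc k)"]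
      by (intro power_mono) (auto simp: dist_norm infdist_nonneg)
    then show ?thesis
      using descent[OF p(1), of k] p(2) by (simp add: dist_norm)
  qed
  have "(\<lambda>k. (infdist (x k) S)\<^sup>2) \<longlonglongrightarrow> 0"
  proof (rule tendsto_0_if_decreasing_above_each_level[OF _ _ lam_diverges])
    show "0 \<le> lam k" for k using lam_pos[of k] by simp
    show "eventually (\<lambda>k. (infdist (x (Suc k)) S)\<^sup>2 \<le> (infdist (x k) S)\<^sup>2 + e) sequentially"
      if "e > 0" for e
    proof -
      have "eventually (\<lambda>k. E k < 1) sequentially"
        using E_null by (rule order_tendstoD) simp
      moreover have "eventually (\<lambda>k. lam k < e / 4) sequentially"
        using lam_null by (rule order_tendstoD) (use \<open>e > 0\<close> in simp)
      ultimately show ?thesis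
        using almost_optimal
      proof eventually_elim
        case (elim k)
        \<comment> \<open>The value exceeds \<open>m - 1\<close> and the error is below 1; hence the increment is
          at most \<open>4 * lam k\<close>.\<close>
        have "lam k * (- 2) \<le> lam k * (g (x k) - m - E k)"
          using elim lam_pos[of k] by (intro mult_left_mono) auto
        then show ?case using set_descent[of k] elim by linarith
      qed
    qed
    show "\<exists>\<delta>>0. eventually (\<lambda>k. e \<le> (infdist (x k) S)\<^sup>2 \<longrightarrow>
        (infdist (x (Suc k)) S)\<^sup>2 \<le> (infdist (x k) S)\<^sup>2 - \<delta> * lam k) sequentially"
      if "e > 0" for e
    proof -
      have "sqrt e > 0" using \<open>e > 0\<close> by simp
      from gap[OF this] obtain \<delta> where "\<delta> > 0"
        and \<delta>: "eventually (\<lambda>k. sqrt e \<le> infdist (x k) S \<longrightarrow> m + \<delta> < g (x k)) sequentially"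
        by blast
      have "eventually (\<lambda>k. E k < \<delta> / 2) sequentially"
        using E_null by (rule order_tendstoD) (use \<open>\<delta> > 0\<close> in simp)
      with \<delta> have "eventually (\<lambda>k. e \<le> (infdist (x k) S)\<^sup>2 \<longrightarrow>
        (infdist (x (Suc k)) S)\<^sup>2 \<le> (infdist (x k) S)\<^sup>2 - \<delta> * lam k) sequentially"
      proof eventually_elim
        case (elim k)
        show ?case
        proof
          assume "e \<le> (infdist (x k) S)\<^sup>2"
          then have "m + \<delta> < g (x k)"
            using elim real_le_lsqrt[of "infdist (x k) S" e] infdist_nonneg real_sqrt_le_iff
            by (metis real_sqrt_abs abs_of_nonneg)
          then have "lam k * (\<delta> / 2) \<le> lam k * (g (x k) - m - E k)"
            using elim lam_pos[of k] by (intro mult_left_mono) auto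
          then show "(infdist (x (Suc k)) S)\<^sup>2 \<le> (infdist (x k) S)\<^sup>2 - \<delta> * lam k"
            using set_descent[of k] by (simp add: algebra_simps)
        qed
      qed
      with \<open>\<delta> > 0\<close> show ?thesis by blast
    qed
  qed auto
  then have "(\<lambda>k. sqrt ((infdist (x k) S)\<^sup>2)) \<longlonglongrightarrow> sqrt 0"
    by (rule tendsto_real_sqrt)
  then show "(\<lambda>k. infdist (x k) S) \<longlonglongrightarrow> 0"
    by (simp add: infdist_nonneg)
qed

theorem theorem1p1:
  fixes M N :: nat
    and C :: "nat \<Rightarrow> 'a::{real_inner,heine_borel} set"
    and D :: "nat \<Rightarrow> 'a set"
    and f :: "nat \<Rightarrow> 'a \<Rightarrow> real"
    and s :: projection_scheme
    and lam L :: "nat \<Rightarrow> real"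
    and x0 :: 'a
    and x :: "nat \<Rightarrow> 'a"
    and y :: "nat \<Rightarrow> nat \<Rightarrow> 'a"
  assumes finite_dim: "\<exists>B :: 'a set. finite B \<and> span B = UNIV"
    and M_pos: "M > 0"
    and N_pos: "N > 0"
    and C_sets: "\<And>i. i \<in> {1..M} \<Longrightarrow> C i \<noteq> {} \<and> closed (C i) \<and> convex (C i)"
    and C_nonempty: "(\<Inter>i\<in>{1..M}. C i) \<noteq> {}"
    and scheme: "valid_scheme M s"
    and generated: "generated_by_algorithm s C M D f N lam x0 x y"
    and f_convex: "\<And>j. j \<in> {1..N} \<Longrightarrow> convex_on (D j) (f j)"
    and y_in_D: "\<And>j k. j \<in> {1..N} \<Longrightarrow> y k (j - 1) \<in> D j"
    and f_defined_on_C: "\<And>j. j \<in> {1..N} \<Longrightarrow> (\<Inter>i\<in>{1..M}. C i) \<subseteq> D j"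
    and f_defined_at_iterates: "\<And>j k. j \<in> {1..N} \<Longrightarrow> x k \<in> D j"
    and f_continuous_on_C: "\<And>j z. j \<in> {1..N} \<Longrightarrow> z \<in> (\<Inter>i\<in>{1..M}. C i) \<Longrightarrow>
          continuous (at z within D j) (f j)"
    and subgradients_bounded: "\<And>j k v. j \<in> {1..N} \<Longrightarrow>
          v \<in> subdifferential (D j) (f j) (y k (j - 1)) \<Longrightarrow> norm v \<le> L j"
    and x_bounded: "bounded (range x)"
    and lam_pos: "\<And>k. lam k > 0"
    and lam_null: "lam \<longlonglongrightarrow> 0"
    and lam_diverges: "filterlim (\<lambda>n. \<Sum>k<n. lam k) at_top sequentially"
    and solvable: "solution_set (\<Inter>i\<in>{1..M}. C i) (objective f N) \<noteq> {}"
  shows "(\<lambda>k. ereal (objective f N (x k))) \<longlonglongrightarrow> optimal_value (\<Inter>i\<in>{1..M}. C i) (objective f N)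
       \<and> (\<forall>z. cluster_point x z \<longrightarrow> z \<in> solution_set (\<Inter>i\<in>{1..M}. C i) (objective f N))"
proof -
  let ?K = "\<Inter>i\<in>{1..M}. C i"
  let ?g = "objective f N"
  let ?S = "solution_set ?K ?g"
  let ?X = "\<Inter>j\<in>{1..N}. D j"
  have K: "closed ?K" "?K \<noteq> {}"
    using C_sets C_nonempty by (auto intro!: closed_INT)
  have y_0: "y k 0 = x k"
    and next_x: "x (Suc k) = scheme_operator s C M k (y k N)" for k
    using generated by (auto simp: generated_by_algorithm_def)
  have y_step: "\<exists>v \<in> subdifferential (D j) (f j) (y k (j - 1)).
      norm v \<le> L j \<and> y k j = y k (j - 1) - lam k *\<^sub>R v" if "j \<in> {1..N}" for j k
    using generated that subgradients_bounded[OF that] unfolding generated_by_algorithm_def by blast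
  have lam_nonneg: "0 \<le> lam k" for k
    using lam_pos[of k] by simp

  have displacement: "dist (y k n) (x k) \<le> lam k * (\<Sum>j=1..n. L j)" if "n \<le> N" for k n
    using incremental_subgradient_displacement[OF lam_nonneg _ that, of L "y k" k] y_step that
    by (simp add: y_0) blast
  have near: "(\<lambda>k. dist (y k n) (x k)) \<longlonglongrightarrow> 0" if "n \<le> N" for n
  proof (rule tendsto_sandwich[of "\<lambda>_. 0"])
    show "(\<lambda>k. lam k * (\<Sum>j=1..n. L j)) \<longlonglongrightarrow> 0"
      using lam_null by (rule tendsto_mult_left_zero)
  qed (use displacement[OF that] in auto)

  obtain F where attr: "\<And>k. strictly_attracting (scheme_operator s C M k) (F k)"
    and F: "(\<Inter>i<M. F i) = ?K" "\<And>k. ?K \<subseteq> F k"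
    using scheme_operator_strictly_attracting[where C = C, OF M_pos C_sets scheme] by blast
  have to_K: "(\<lambda>k. infdist (x k) ?K) \<longlonglongrightarrow> 0"
    by (rule periodic_attracting_asymptotically_feasible[OF M_pos attr scheme_operator_periodic
          F(1)[symmetric] F(2) K x_bounded next_x near[OF order_refl]])

  have value_diff: "(\<lambda>k. f j (y k (j - 1)) - f j (x k)) \<longlonglongrightarrow> 0" if "j \<in> {1..N}" for j
  proof -
    have "j - 1 \<le> N" using that by auto
    note near_j = near[OF this]
    show ?thesis
      by (rule nearby_values_near_set_of_continuity[where K = ?K and X = "D j"])
        (fact K f_continuous_on_C[OF that] f_defined_at_iterates[OF that] y_in_D[OF that]
          x_bounded to_K near_j)+
  qed
  \<comment> \<open>The error collects the change of the function values within a pass and the quadratic term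
    of the expansion.\<close>
  define E where "E k = lam k * (\<Sum>j=1..N. (L j)\<^sup>2) / 2
    - (\<Sum>j=1..N. f j (y k (j - 1)) - f j (x k))" for k
  have "(\<lambda>k. lam k * (\<Sum>j=1..N. (L j)\<^sup>2) / 2
      - (\<Sum>j=1..N. f j (y k (j - 1)) - f j (x k))) \<longlonglongrightarrow> 0 * (\<Sum>j=1..N. (L j)\<^sup>2) / 2 - 0"
    by (intro tendsto_diff tendsto_divide tendsto_mult lam_null tendsto_const tendsto_null_sum
        value_diff) auto
  then have E_null: "E \<longlonglongrightarrow> 0"
    by (simp add: E_def[abs_def])
  have descent: "(norm (x (Suc k) - z))\<^sup>2 \<le>
      (norm (x k - z))\<^sup>2 - 2 * lam k * (?g (x k) - ?g z - E k)" if "z \<in> ?K" for k z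
  proof -
    have "dist (x (Suc k)) z \<le> dist (y k N) z"
      using attr[of k] F(2)[of k] that unfolding strictly_attracting_def next_x by (metis subsetD)
    then have "(norm (x (Suc k) - z))\<^sup>2 \<le> (norm (y k N - z))\<^sup>2"
      by (simp add: dist_norm power_mono)
    also have "\<dots> \<le> (norm (y k 0 - z))\<^sup>2
        - 2 * lam k * (\<Sum>j=1..N. f j (y k (j - 1)) - f j z) + (lam k)\<^sup>2 * (\<Sum>j=1..N. (L j)\<^sup>2)"
      using f_defined_on_C that y_step
      by (intro incremental_subgradient_descent[OF lam_nonneg, where D = D]) blast+
    also have "\<dots> = (norm (x k - z))\<^sup>2 - 2 * lam k * (?g (x k) - ?g z - E k)"
      by (simp add: E_def objective_def y_0 sum_subtractf power2_eq_square algebra_simps)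
    finally show ?thesis .
  qed

  obtain xs where xs: "xs \<in> ?S" using solvable by blast
  define m where "m = ?g xs"
  have opt: "optimal_value ?K ?g = ereal m"
    using xs by (simp add: solution_set_def m_def)
  have min: "m \<le> ?g z" if "z \<in> ?K" for z
  proof -
    have "optimal_value ?K ?g \<le> ereal (?g z)"
      unfolding optimal_value_def using that by (rule INF_lower)
    then show ?thesis unfolding opt by simp
  qed
  have S_eq: "?S = {z \<in> ?K. ?g z = m}"
    unfolding solution_set_def opt by simp
  have K_X: "?K \<subseteq> ?X"
    using f_defined_on_C by blast
  have x_X: "x k \<in> ?X" for k
    using f_defined_at_iterates by blast
  have cont: "continuous (at z within ?X) ?g" if "z \<in> ?K" for z
    unfolding objective_def
    by (intro continuous_sum continuous_within_subset[OF f_continuous_on_C[OF _ that]]) auto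
  have descent_S: "(norm (x (Suc k) - z))\<^sup>2 \<le> (norm (x k - z))\<^sup>2 - 2 * lam k * (?g (x k) - m - E k)"
    if "z \<in> ?S" for k z
  proof -
    from that have "z \<in> ?K" "?g z = m"
      unfolding S_eq by blast+
    with descent[of z k] show ?thesis by simp
  qed
  have convergence: "closed ?S" "(\<lambda>k. infdist (x k) ?S) \<longlonglongrightarrow> 0"
    by (rule descent_towards_minimizers[where K = ?K and X = ?X and g = ?g and m = m
            and lam = lam and E = E];
        fact K K_X cont x_X S_eq solvable min x_bounded to_K lam_pos lam_null lam_diverges
          E_null descent_S)+
  have limit: "z \<in> ?S" if "strict_mono r" "(\<lambda>n. x (r n)) \<longlonglongrightarrow> z" for r z
    using subsequence_limit_in_closed[OF convergence(1) solvable convergence(2)] that by blast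

  have "(\<lambda>k. ?g (x k)) \<longlonglongrightarrow> m"
  proof (rule tendstoI)
    fix e :: real
    assume "e > 0"
    show "eventually (\<lambda>k. dist (?g (x k)) m < e) sequentially"
    proof (rule eventually_if_along_convergent_subsequences[OF x_bounded])
      fix r z
      assume r: "strict_mono r" "(\<lambda>n. x (r n)) \<longlonglongrightarrow> z"
      then have z: "z \<in> ?K" "?g z = m"
        using limit unfolding S_eq by blast+
      have "(\<lambda>n. ?g (x (r n))) \<longlonglongrightarrow> m"
        using continuous_within_along_sequence[OF cont[OF z(1)] x_X r(2)] z(2) by simp
      with \<open>e > 0\<close> show "eventually (\<lambda>n. dist (?g (x (r n))) m < e) sequentially"
        by (simp add: tendsto_iff)
    qed
  qed
  then have "(\<lambda>k. ereal (?g (x k))) \<longlonglongrightarrow> optimal_value ?K ?g"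
    unfolding opt by simp
  moreover have "z \<in> ?S" if "cluster_point x z" for z
    using that limit by (auto simp: cluster_point_def comp_def)
  ultimately show ?thesis by blast
qed

end
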